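(* Let $n$ be a positive integer, let $A, B\in \mathbb{C}^{n\times n}$ and let $C=A+B$. Then $$|\Lambda(C)|\leq \big(r(B)+1\big)|\Lambda(A)|+d(A)-d(C)-|\Lambda(A)\setminus \Lambda(C)|.$$ Specifically, if the spectra of $A$ and $C$ are disjoint, i.e. $\Lambda(A)\cap\Lambda(C)=\emptyset$, then $$|\Lambda(C)|\leq r(B)|\Lambda(A)|+d(A)-d(C).$$
   Context: For $M\in\mathbb{C}^{n\times n}$: $r(M)$ is the rank of $M$; $\Lambda(M)$ is the set of all distinct eigenvalues of $M$ in $\mathbb{C}$, and $|\cdot|$ denotes the cardinality of a finite set. For $\lambda\in\Lambda(M)$, $m_a(M,\lambda)$ is the algebraic multiplicity of $\lambda$ (its multiplicity as a root of the characteristic polynomial of $M$) and $m_g(M,\lambda)$ is its geometric multiplicity (the dimension of the eigenspace of $M$ corresponding to $\lambda$). The defectivity of an eigenvalue is $d(M,\lambda)=m_a(M,\lambda)-m_g(M,\lambda)$, and the defectivity of the matrix is $d(M)=\sum_{\lambda\in\Lambda(M)}d(M,\lambda)$. *)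

theory Defs
  imports
    "Jordan_Normal_Form.Spectral_Radius"
    "Jordan_Normal_Form.Matrix_Kernel"
    "Jordan_Normal_Form.DL_Rank"
begin

definition alg_mult :: "complex mat \<Rightarrow> complex \<Rightarrow> nat" where
  "alg_mult M k = Polynomial.order k (char_poly M)"

definition geom_mult :: "complex mat \<Rightarrow> complex \<Rightarrow> nat" where
  "geom_mult M k = kernel_dim (char_matrix M k)"

text \<open>The matrix \<^term>\<open>char_matrix M k\<close> is \<open>M - k I\<close>, so its kernel is the eigenspace of \<open>k\<close>.\<close>

lemma mat_kernel_char_matrix:
  fixes M :: "complex mat"
  assumes M: "M \<in> carrier_mat n n"
  shows "mat_kernel (char_matrix M k) = {v \<in> carrier_vec n. M *\<^sub>v v = k \<cdot>\<^sub>v v}"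
proof -
  have "char_matrix M k *\<^sub>v v = 0\<^sub>v n \<longleftrightarrow> M *\<^sub>v v = k \<cdot>\<^sub>v v"
    if v: "v \<in> carrier_vec n" for v
  proof (cases "v = 0\<^sub>v n")
    case True
    then show ?thesis
      using M by (auto simp: char_matrix_def)
  next
    case False
    then show ?thesis
      using eigenvector_char_matrix[OF M, of v k] M v by (auto simp: eigenvector_def)
  qed
  moreover have "char_matrix M k \<in> carrier_mat n n"
    using M by simp
  ultimately show ?thesis
    by (auto simp: mat_kernel)
qed

text \<open>Defectivities are integers, so that the differences below are not truncated.\<close>

definition eigenvalue_defectivity :: "complex mat \<Rightarrow> complex \<Rightarrow> int" where
  "eigenvalue_defectivity M k = int (alg_mult M k) - int (geom_mult M k)"

definition defectivity :: "complex mat \<Rightarrow> int" where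
  "defectivity M = (\<Sum>k\<in>spectrum M. eigenvalue_defectivity M k)"

end

theory Submission
  imports Defs
begin

text \<open>
  Algebraic multiplicities sum to \<open>n\<close>, so \<open>d(M)\<close> equals \<open>n\<close> minus the sum of the geometric
  multiplicities. Subadditivity of the rank gives \<open>m\<^sub>g(A, k) \<le> m\<^sub>g(C, k) + r(B)\<close> for every \<open>k\<close>; summing
  this over the spectrum of \<open>A\<close> and bounding \<open>m\<^sub>g(C, k)\<close> below by 1 at the eigenvalues of \<open>C\<close>
  outside the spectrum of \<open>A\<close> yields the inequality.
\<close>

text \<open>Rank-nullity for the linear map given by \<open>A\<close>: its image is the span of the
  columns and its kernel is \<open>mat_kernel A\<close>.\<close>

lemma rank_plus_kernel_dim:
  fixes A :: "'a :: field mat"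
  assumes A: "A \<in> carrier_mat nr nc"
  shows "vec_space.rank nr A + kernel_dim A = nc"
proof -
  interpret V: vec_space "TYPE('a)" nc .
  interpret W: vec_space "TYPE('a)" nr .
  interpret K: kernel nr nc A
    by unfold_locales (rule A)
  interpret T: linear_map class_ring V.V W.V "\<lambda>v. A *\<^sub>v v"
    by unfold_locales
      (use A in \<open>auto simp: module_hom_def mult_add_distrib_mat_vec mult_mat_vec module_vec_simps\<close>)
  have im: "T.im = W.span (set (cols A))"
    using A unfolding W.col_space_eq[OF A, unfolded W.col_space_def] T.im_def
    by (auto simp: module_vec_simps)
  have ker: "T.ker = mat_kernel A"
    using A unfolding T.ker_def by (auto simp: mat_kernel module_vec_simps)
  show ?thesis
    using T.rank_nullity[OF V.fin_dim] A
    unfolding im ker by (simp add: W.rank_def kernel_dim_def V.dim_is_n)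
qed

lemma char_matrix_add:
  fixes A B :: "'a :: field mat"
  assumes "A \<in> carrier_mat n n" "B \<in> carrier_mat n n"
  shows "char_matrix (A + B) k = char_matrix A k + B"
  using assms by (intro eq_matI) (auto simp: char_matrix_def)

text \<open>Shifting by \<open>k\<close> leaves the perturbation \<open>B\<close> unchanged, so the
  ranks of the two characteristic matrices differ by at most the rank of \<open>B\<close> in the
  direction needed; rank-nullity turns this into kernel dimensions. \<open>k\<close> need not be an
  eigenvalue of either matrix.\<close>

lemma geom_mult_le_perturbed:
  assumes A: "A \<in> carrier_mat n n" and B: "B \<in> carrier_mat n n"
  shows "geom_mult A k \<le> geom_mult (A + B) k + vec_space.rank n B"
proof -
  have "char_matrix A k \<in> carrier_mat n n" "char_matrix (A + B) k \<in> carrier_mat n n"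
    using A B by simp_all
  from this[THEN rank_plus_kernel_dim] vec_space.rank_subadditive[OF this(1) B]
  show ?thesis
    unfolding geom_mult_def char_matrix_add[OF A B] by linarith
qed

text \<open>Eigenvalues are the \<open>k\<close> at which \<open>char_matrix M k\<close> is
  singular, that is, has rank other than \<open>n\<close>.\<close>

lemma geom_mult_pos_iff:
  assumes M: "M \<in> carrier_mat n n"
  shows "0 < geom_mult M k \<longleftrightarrow> k \<in> spectrum M"
proof -
  interpret vec_space "TYPE(complex)" n .
  have M': "char_matrix M k \<in> carrier_mat n n"
    using M by simp
  have "k \<in> spectrum M \<longleftrightarrow> rank (char_matrix M k) \<noteq> n"
    unfolding spectrum_def using eigenvalue_det[OF M] det_rank_iff[OF M'] by auto
  then show ?thesis
    using rank_plus_kernel_dim[OF M'] unfolding geom_mult_def by linarith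
qed

text \<open>Over the complex numbers the characteristic polynomial splits, so its roots counted with
  multiplicity number its degree.\<close>

lemma sum_alg_mult:
  assumes M: "M \<in> carrier_mat n n"
  shows "(\<Sum>k\<in>spectrum M. alg_mult M k) = n"
proof -
  have deg: "degree (char_poly M) = n" and "char_poly M \<noteq> 0"
    using degree_monic_char_poly[OF M] by auto
  then have "(\<Sum>k\<in>spectrum M. alg_mult M k) = size (proots (char_poly M))"
    unfolding spectrum_root_char_poly[OF M] size_multiset_overloaded_eq
    by (simp add: alg_mult_def)
  then show ?thesis
    using deg by (simp add: size_proots_complex)
qed

lemma defectivity_eq:
  assumes M: "M \<in> carrier_mat n n"
  shows "defectivity M = int n - (\<Sum>k\<in>spectrum M. int (geom_mult M k))"
  unfolding defectivity_def eigenvalue_defectivity_def sum_subtractf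
  by (simp flip: sum_alg_mult[OF M])

theorem theorem2p4:
  fixes n :: nat and A B C :: "complex mat"
  assumes "n > 0"
    and "A \<in> carrier_mat n n"
    and "B \<in> carrier_mat n n"
    and "C = A + B"
  shows "int (card (spectrum C)) \<le>
      (int (vec_space.rank n B) + 1) * int (card (spectrum A))
      + defectivity A - defectivity C - int (card (spectrum A - spectrum C))
    \<and> (spectrum A \<inter> spectrum C = {} \<longrightarrow>
      int (card (spectrum C)) \<le>
      int (vec_space.rank n B) * int (card (spectrum A)) + defectivity A - defectivity C)"
proof -
  let ?S = "spectrum A" and ?T = "spectrum C" and ?r = "int (vec_space.rank n B)"
  let ?g = "\<lambda>k. int (geom_mult C k)"
  have C: "C \<in> carrier_mat n n"
    using assms by simp
  have fin: "finite ?S" "finite ?T"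
    using card_finite_spectrum(1) assms(2) C by blast+
  have g: "1 \<le> ?g k \<longleftrightarrow> k \<in> ?T" for k
    using geom_mult_pos_iff[OF C, of k] by linarith
  have "(\<Sum>k\<in>?S. int (geom_mult A k)) \<le> (\<Sum>k\<in>?S. ?g k + ?r)"
    using geom_mult_le_perturbed[OF assms(2,3)] unfolding assms(4)
    by (intro sum_mono) (simp flip: of_nat_add)
  also have "\<dots> = sum ?g ?S + ?r * int (card ?S)"
    by (simp add: sum.distrib)
  \<comment> \<open>Outside \<open>?T\<close> the geometric multiplicity in \<open>C\<close> is
    0.\<close>
  also have "sum ?g ?S = sum ?g (?S \<inter> ?T)"
    using fin g by (intro sum.mono_neutral_right) fastforce+
  finally have A_bound: "(\<Sum>k\<in>?S. int (geom_mult A k)) \<le> sum ?g (?S \<inter> ?T) + ?r * int (card ?S)" .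
  have "(\<Sum>k\<in>?T - ?S. 1) \<le> sum ?g (?T - ?S)"
    using g by (intro sum_mono) auto
  then have C_bound: "int (card (?T - ?S)) + sum ?g (?S \<inter> ?T) \<le> sum ?g ?T"
    using sum.Int_Diff[OF fin(2), of ?g ?S] by (simp add: Int_commute)
  \<comment> \<open>Eliminating the common part expresses \<open>card ?T\<close> by
    \<open>card ?S\<close>: this produces the \<open>+ 1\<close> in the factor and the subtracted
    \<open>card (?S - ?T)\<close>.\<close>
  have "card ?S = card (?S \<inter> ?T) + card (?S - ?T)" "card ?T = card (?S \<inter> ?T) + card (?T - ?S)"
    using card_Int_Diff fin by (metis, metis Int_commute)
  then have main: "int (card ?T) \<le> (?r + 1) * int (card ?S) + defectivity A - defectivity C
      - int (card (?S - ?T))"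
    using A_bound C_bound defectivity_eq[OF assms(2)] defectivity_eq[OF C]
    by (simp add: distrib_right)
  \<comment> \<open>For disjoint spectra the subtracted cardinality is \<open>card ?S\<close>, which
    cancels the \<open>+ 1\<close>.\<close>
  moreover have "?S - ?T = ?S" if "?S \<inter> ?T = {}"
    using that by blast
  ultimately show ?thesis
    by (auto simp: distrib_right)
qed

end
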